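(* Let $N\ge 1$ and let $p$ be a polynomial with $\deg p\le 2N$. Then $$\frac{p(\alpha_N)+p(\beta_N)}{2}=p(\gamma)|_N.$$
   Context: $J_N$ is the $N\times N$ exchange matrix, $Q_N=\begin{pmatrix}J_N & I_N\end{pmatrix}$ ($N\times 2N$), and $\sigma_{2N}(\varepsilon)$ is the $2N\times 2N$ matrix (indices $0,\dots,2N-1$) with $(i,j)$ entry $1$ if $i=j+1$, $\varepsilon$ if $(i,j)=(0,2N-1)$, $0$ otherwise. $\alpha_N=Q_N\sigma_{2N}(1)Q_N^\top$ and $\beta_N=Q_N\sigma_{2N}(-1)Q_N^\top$ (equivalently, $\alpha_N$ resp. $\beta_N$ is the leading $N\times N$ block of $\gamma$ with its $(N-1,N-1)$ entry increased resp. decreased by $1$). $\gamma$ is the infinite matrix indexed by $\mathbb{Z}_{\ge 0}$ with $(i,j)$ entry $1$ if $|i-j|=1$ or $i=j=0$, and $0$ otherwise; polynomials in $\gamma$ are well-defined since each row and column is finitely supported, and constants mean multiples of the identity. For a (finite or infinite) matrix $M$, $M|_N$ is its leading principal $N\times N$ submatrix (rows and columns $0,\dots,N-1$). *)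

theory Defs
  imports "Jordan_Normal_Form.Matrix" "HOL-Computational_Algebra.Polynomial"
    "HOL-Library.Groups_Big_Fun"
begin

definition exchange_mat :: "nat \<Rightarrow> 'a :: zero_neq_one mat" where
  "exchange_mat N = mat N N (\<lambda>(i, j). if i + j = N - 1 then 1 else 0)"

definition Q_mat :: "nat \<Rightarrow> 'a :: zero_neq_one mat" where
  "Q_mat N = mat N (2 * N)
     (\<lambda>(i, j). if j < N then exchange_mat N $$ (i, j) else 1\<^sub>m N $$ (i, j - N))"

definition sigma_mat :: "nat \<Rightarrow> 'a :: zero_neq_one \<Rightarrow> 'a mat" where
  "sigma_mat m \<epsilon> = mat m m
     (\<lambda>(i, j). if i = j + 1 then 1 else if (i, j) = (0, m - 1) then \<epsilon> else 0)"

definition alpha_mat :: "nat \<Rightarrow> 'a :: comm_ring_1 mat" where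
  "alpha_mat N = Q_mat N * sigma_mat (2 * N) 1 * transpose_mat (Q_mat N)"

definition beta_mat :: "nat \<Rightarrow> 'a :: comm_ring_1 mat" where
  "beta_mat N = Q_mat N * sigma_mat (2 * N) (- 1) * transpose_mat (Q_mat N)"

text \<open>Evaluation of a polynomial at a square matrix. The sum of matrices is written entrywise
  because the type of matrices of arbitrary dimension has no zero.\<close>

definition mat_poly :: "'a :: comm_ring_1 poly \<Rightarrow> 'a mat \<Rightarrow> 'a mat" where
  "mat_poly p A = mat (dim_row A) (dim_row A)
     (\<lambda>ij. \<Sum>k\<le>degree p. coeff p k * (A ^\<^sub>m k) $$ ij)"

text \<open>Matrices indexed by the natural numbers. \<^const>\<open>Sum_any\<close> is the sum over the support of the
  summand, and is \<open>0\<close> if that support is infinite, so the product below is meaningful only if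
  the left factor has finitely supported rows or the right factor finitely supported columns.\<close>

type_synonym 'a inf_mat = "nat \<Rightarrow> nat \<Rightarrow> 'a"

definition inf_mat_one :: "'a :: zero_neq_one inf_mat" where
  "inf_mat_one = (\<lambda>i j. if i = j then 1 else 0)"

definition inf_mat_mult :: "'a :: comm_ring_1 inf_mat \<Rightarrow> 'a inf_mat \<Rightarrow> 'a inf_mat" where
  "inf_mat_mult A B = (\<lambda>i j. Sum_any (\<lambda>k. A i k * B k j))"

primrec inf_mat_pow :: "'a :: comm_ring_1 inf_mat \<Rightarrow> nat \<Rightarrow> 'a inf_mat" where
  "inf_mat_pow A 0 = inf_mat_one"
| "inf_mat_pow A (Suc k) = inf_mat_mult (inf_mat_pow A k) A"

definition inf_mat_poly :: "'a :: comm_ring_1 poly \<Rightarrow> 'a inf_mat \<Rightarrow> 'a inf_mat" where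
  "inf_mat_poly p A = (\<lambda>i j. \<Sum>k\<le>degree p. coeff p k * inf_mat_pow A k i j)"

definition leading_submat :: "nat \<Rightarrow> 'a inf_mat \<Rightarrow> 'a mat" where
  "leading_submat N A = mat N N (\<lambda>(i, j). A i j)"

definition gamma_mat :: "'a :: zero_neq_one inf_mat" where
  "gamma_mat = (\<lambda>i j. if \<bar>int i - int j\<bar> = 1 \<or> i = 0 \<and> j = 0 then 1 else 0)"

text \<open>The powers of \<^const>\<open>gamma_mat\<close> are well-defined: all rows and columns are finitely supported.\<close>

definition row_col_finite :: "'a :: zero inf_mat \<Rightarrow> bool" where
  "row_col_finite A \<longleftrightarrow> (\<forall>i. finite {j. A i j \<noteq> 0}) \<and> (\<forall>j. finite {i. A i j \<noteq> 0})"

lemma row_col_finite_one: "row_col_finite inf_mat_one"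
  by (simp add: row_col_finite_def inf_mat_one_def)

lemma row_col_finite_gamma: "row_col_finite gamma_mat"
  unfolding row_col_finite_def
proof (intro conjI allI)
  fix i :: nat
  have "{j. (gamma_mat i j :: 'a) \<noteq> 0} \<subseteq> {..Suc i}" "{j. (gamma_mat j i :: 'a) \<noteq> 0} \<subseteq> {..Suc i}"
    by (auto simp: gamma_mat_def split: if_splits)
  then show "finite {j. (gamma_mat i j :: 'a) \<noteq> 0}" "finite {j. (gamma_mat j i :: 'a) \<noteq> 0}"
    by (auto intro: finite_subset)
qed

lemma inf_mat_mult_nonzero:
  assumes "inf_mat_mult A B i j \<noteq> 0"
  obtains k where "A i k \<noteq> 0" "B k j \<noteq> 0"
proof -
  from assms obtain k where "A i k * B k j \<noteq> 0"
    unfolding inf_mat_mult_def by (rule Sum_any.not_neutral_obtains_not_neutral)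
  then have "A i k \<noteq> 0" "B k j \<noteq> 0" by auto
  then show ?thesis by (rule that)
qed

lemma row_col_finite_mult:
  assumes "row_col_finite A" "row_col_finite B"
  shows "row_col_finite (inf_mat_mult A B)"
  unfolding row_col_finite_def
proof (intro conjI allI)
  fix i
  have "{j. inf_mat_mult A B i j \<noteq> 0} \<subseteq> (\<Union>k\<in>{k. A i k \<noteq> 0}. {j. B k j \<noteq> 0})"
    by (auto elim: inf_mat_mult_nonzero)
  with assms show "finite {j. inf_mat_mult A B i j \<noteq> 0}"
    by (auto simp: row_col_finite_def intro: finite_subset)
next
  fix j
  have "{i. inf_mat_mult A B i j \<noteq> 0} \<subseteq> (\<Union>k\<in>{k. B k j \<noteq> 0}. {i. A i k \<noteq> 0})"
    by (auto elim: inf_mat_mult_nonzero)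
  with assms show "finite {i. inf_mat_mult A B i j \<noteq> 0}"
    by (auto simp: row_col_finite_def intro: finite_subset)
qed

lemma row_col_finite_gamma_pow: "row_col_finite (inf_mat_pow gamma_mat k)"
  by (induction k) (simp_all add: row_col_finite_one row_col_finite_mult row_col_finite_gamma)

end

theory Submission
  imports Defs
begin

text \<open>For \<open>\<epsilon> = \<plusminus>1\<close>, fold the half-line onto \<open>{0..<N}\<close> by reflecting at \<open>N - 1/2\<close> and at \<open>-1/2\<close>,
  where every reflection at the right end carries the sign \<open>\<epsilon>\<close>. The \<open>k\<close>-th power of
  \<open>Q\<^sub>N \<sigma>(\<epsilon>) Q\<^sub>N\<^sup>T\<close> is then the folding of \<open>\<gamma>\<^sup>k\<close>: the indices over \<open>j\<close> are
  \<open>j, 2N-1-j, 2N+j, 4N-1-j, \<dots>\<close>, with signs \<open>1, \<epsilon>, \<epsilon>, 1, \<dots>\<close>. Averaging over \<open>\<epsilon> = \<plusminus>1\<close> removes the second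
  and third index, and those from \<open>4N-1-j \<ge> 3N\<close> on are out of reach of a walk of length at most
  \<open>2N\<close> that starts below \<open>N\<close>.\<close>

text \<open>At \<open>j = 0\<close> truncated subtraction gives \<open>j - 1 = 0\<close>, which
  picks up exactly the corner entry of \<open>gamma_mat\<close>, so one formula covers all
  columns.\<close>

lemma inf_mat_mult_gamma:
  "inf_mat_mult A gamma_mat i j = A i (j - 1) + A i (Suc j)"
proof -
  have "inf_mat_mult A gamma_mat i j = (\<Sum>k\<in>{j - 1, Suc j}. A i k * gamma_mat k j)"
    unfolding inf_mat_mult_def
    by (rule Sum_any.expand_superset) (auto simp: gamma_mat_def split: if_splits)
  then show ?thesis
    by (auto simp: gamma_mat_def)
qed

text \<open>Each factor \<open>gamma_mat\<close> widens the band by one: a walk of length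
  \<open>k\<close> moves at most \<open>k\<close> places.\<close>

lemma gamma_pow_eq_0:
  "i + k < j \<Longrightarrow> inf_mat_pow gamma_mat k i j = 0"
  by (induction k arbitrary: j) (simp_all add: inf_mat_one_def inf_mat_mult_gamma)

text \<open>Keeping the sign \<epsilon> as a parameter lets one induction serve both
  matrices.\<close>

definition folded_mat :: "nat \<Rightarrow> 'a :: comm_ring_1 \<Rightarrow> 'a mat" where
  "folded_mat N \<epsilon> = Q_mat N * sigma_mat (2 * N) \<epsilon> * transpose_mat (Q_mat N)"

lemma alpha_mat_eq_folded: "alpha_mat N = folded_mat N 1"
  and beta_mat_eq_folded: "beta_mat N = folded_mat N (- 1)"
  by (simp_all add: alpha_mat_def beta_mat_def folded_mat_def)

lemma Q_mat_carrier: "Q_mat N \<in> carrier_mat N (2 * N)"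
  by (simp add: Q_mat_def)

lemma sigma_mat_carrier: "sigma_mat m \<epsilon> \<in> carrier_mat m m"
  by (simp add: sigma_mat_def)

lemma folded_mat_carrier: "folded_mat N \<epsilon> \<in> carrier_mat N N"
  unfolding folded_mat_def using Q_mat_carrier sigma_mat_carrier by fastforce

lemma sum_Q_mat:
  fixes f :: "nat \<Rightarrow> 'a :: comm_ring_1"
  assumes "i < N"
  shows "(\<Sum>a<2 * N. Q_mat N $$ (i, a) * f a) = f (N - 1 - i) + f (N + i)"
proof -
  have "(\<Sum>a<2 * N. Q_mat N $$ (i, a) * f a)
      = (\<Sum>a<2 * N. (if a = N - 1 - i then f a else 0) + (if a = N + i then f a else 0))"
    using assms by (intro sum.cong) (auto simp: Q_mat_def exchange_mat_def)
  also have "\<dots> = f (N - 1 - i) + f (N + i)"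
    using assms by (simp add: sum.distrib)
  finally show ?thesis .
qed

lemma folded_mat_index:
  assumes "i < N" and "j < N"
  shows "folded_mat N \<epsilon> $$ (i, j) = (if i = j - 1 then 1 else 0) + (if i = Suc j then 1 else 0)
           + (if i = N - 1 \<and> j = N - 1 then \<epsilon> else 0)"
proof -
  let ?s = "\<lambda>a b. sigma_mat (2 * N) \<epsilon> $$ (a, b)"
  have QS: "(Q_mat N * sigma_mat (2 * N) \<epsilon>) $$ (i, b) = ?s (N - 1 - i) b + ?s (N + i) b"
    if "b < 2 * N" for b
    using that assms sum_Q_mat[OF assms(1), of "\<lambda>a. ?s a b"] Q_mat_carrier[of N, where 'a = 'a]
      sigma_mat_carrier[of "2 * N" \<epsilon>]
    by (simp add: scalar_prod_def lessThan_atLeast0)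
  have "folded_mat N \<epsilon> $$ (i, j)
      = (\<Sum>b<2 * N. Q_mat N $$ (j, b) * (Q_mat N * sigma_mat (2 * N) \<epsilon>) $$ (i, b))"
    using assms Q_mat_carrier[of N, where 'a = 'a] sigma_mat_carrier[of "2 * N" \<epsilon>]
    unfolding folded_mat_def
    by (subst index_mult_mat)
       (auto simp: scalar_prod_def lessThan_atLeast0 mult.commute intro!: sum.cong)
  also have "\<dots> = ?s (N - 1 - i) (N - 1 - j) + ?s (N + i) (N - 1 - j)
      + (?s (N - 1 - i) (N + j) + ?s (N + i) (N + j))"
    using assms by (subst sum_Q_mat) (simp_all add: QS)
  also have "\<dots> = (if i = j - 1 then 1 else 0) + (if i = Suc j then 1 else 0)
      + (if i = N - 1 \<and> j = N - 1 then \<epsilon> else 0)"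
  proof -
    have "?s (N - 1 - i) (N - 1 - j) = (if j = Suc i then 1 else 0)"
      using assms by (simp add: sigma_mat_def; linarith)
    moreover have "?s (N + i) (N - 1 - j) = (if i = 0 \<and> j = 0 then 1 else 0)"
      using assms by (simp add: sigma_mat_def; linarith)
    moreover have "?s (N - 1 - i) (N + j) = (if i = N - 1 \<and> j = N - 1 then \<epsilon> else 0)"
      using assms by (simp add: sigma_mat_def; linarith)
    moreover have "?s (N + i) (N + j) = (if i = Suc j then 1 else 0)"
      using assms by (simp add: sigma_mat_def)
    ultimately show ?thesis
      by (cases j) simp_all
  qed
  finally show ?thesis .
qed

text \<open>This is the recurrence of \<open>inf_mat_mult_gamma\<close>, except that a step beyond
  \<open>N - 1\<close> is reflected back with sign \<epsilon>.\<close>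

lemma sum_folded_mat:
  fixes f :: "nat \<Rightarrow> 'a :: comm_ring_1"
  assumes "j < N"
  shows "(\<Sum>l<N. f l * folded_mat N \<epsilon> $$ (l, j))
    = f (j - 1) + (if j = N - 1 then \<epsilon> * f j else f (Suc j))"
proof -
  have "(\<Sum>l<N. f l * folded_mat N \<epsilon> $$ (l, j))
      = (\<Sum>l<N. (if l = j - 1 then f l else 0) + (if l = Suc j then f l else 0)
          + (if l = N - 1 then if j = N - 1 then \<epsilon> * f l else 0 else 0))"
    using assms by (intro sum.cong) (auto simp: folded_mat_index algebra_simps)
  also have "\<dots> = f (j - 1) + (if j = N - 1 then \<epsilon> * f j else f (Suc j))"
    using assms by (auto simp: sum.distrib)
  finally show ?thesis .
qed

text \<open>By induction, both sides obey the same recurrence in \<open>k\<close>; only the two ends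
  of the index range need an argument.\<close>

lemma folded_mat_pow_index:
  fixes \<epsilon> :: "'a :: comm_ring_1"
  assumes "\<epsilon> * \<epsilon> = 1" and "k \<le> 2 * N" and "i < N" and "j < N"
  shows "(folded_mat N \<epsilon> ^\<^sub>m k) $$ (i, j) = inf_mat_pow gamma_mat k i j
    + \<epsilon> * (inf_mat_pow gamma_mat k i (2 * N - 1 - j) + inf_mat_pow gamma_mat k i (2 * N + j))"
  using assms(2,4)
proof (induction k arbitrary: j)
  case 0
  then show ?case
    using \<open>i < N\<close> folded_mat_carrier[of N \<epsilon>] by (auto simp: inf_mat_one_def)
next
  case (Suc k)
  define g where "g = inf_mat_pow (gamma_mat :: 'a inf_mat) k i"
  define f where "f l = g l + \<epsilon> * (g (2 * N - 1 - l) + g (2 * N + l))" for l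
  have pow_carrier: "folded_mat N \<epsilon> ^\<^sub>m k \<in> carrier_mat N N"
    by (rule pow_carrier_mat[OF folded_mat_carrier])
  have "(folded_mat N \<epsilon> ^\<^sub>m Suc k) $$ (i, j) = (\<Sum>l<N. f l * folded_mat N \<epsilon> $$ (l, j))"
    using Suc \<open>i < N\<close> pow_carrier folded_mat_carrier[of N \<epsilon>]
    by (auto simp: scalar_prod_def lessThan_atLeast0 f_def g_def intro!: sum.cong)
  also have "\<dots> = f (j - 1) + (if j = N - 1 then \<epsilon> * f j else f (Suc j))"
    using Suc.prems by (intro sum_folded_mat)
  also have "\<dots> = g (j - 1) + g (Suc j)
      + \<epsilon> * (g (2 * N - 1 - j - 1) + g (2 * N - j) + (g (2 * N + j - 1) + g (Suc (2 * N + j))))"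
  proof -
    have left: "f (j - 1) = g (j - 1) + \<epsilon> * (g (2 * N - j) + g (2 * N + j - 1))" if "j > 0"
      using that Suc.prems by (simp add: f_def)
    \<comment> \<open>Left end: the images \<open>2 * N - 1\<close> and \<open>2 * N\<close> of
      \<open>0\<close> are adjacent, so the reflection merely swaps them.\<close>
    have left0: "f 0 = g 0 + \<epsilon> * (g (2 * N - 1) + g (2 * N))"
      by (simp add: f_def)
    have inner: "f (Suc j) = g (Suc j) + \<epsilon> * (g (2 * N - 1 - j - 1) + g (Suc (2 * N + j)))"
      by (simp add: f_def)
    have right: "\<epsilon> * f j = g (Suc j) + \<epsilon> * (g (2 * N - 1 - j - 1) + g (Suc (2 * N + j)))"
      if "j = N - 1"
    proof -
      \<comment> \<open>The indices are \<open>3 * N - 1\<close> and \<open>3 * N\<close>, while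
        \<open>i + k \<le> 3 * N - 2\<close> since \<open>Suc k \<le> 2 * N\<close>. This is where
        the bound on the length enters.\<close>
      have "g (2 * N + j) = 0" "g (Suc (2 * N + j)) = 0"
        using that Suc.prems \<open>i < N\<close> unfolding g_def by (intro gamma_pow_eq_0; linarith)+
      moreover have "2 * N - 1 - j = Suc j" "2 * N - 1 - j - 1 = j"
        using that Suc.prems by linarith+
      ultimately show ?thesis
        using \<open>\<epsilon> * \<epsilon> = 1\<close> by (simp add: f_def distrib_left mult.assoc[symmetric])
    qed
    show ?thesis
      using left left0 inner right by (cases "j = 0") (simp_all add: algebra_simps)
  qed
  finally show ?case
    using Suc.prems by (simp add: inf_mat_mult_gamma g_def Suc_diff_Suc)
qed

theorem theorem5p2:
  fixes N :: nat and p :: "'a :: field_char_0 poly"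
  assumes "N \<ge> 1" and "degree p \<le> 2 * N"
  shows "(1 / 2) \<cdot>\<^sub>m (mat_poly p (alpha_mat N) + mat_poly p (beta_mat N))
           = leading_submat N (inf_mat_poly p gamma_mat)"
proof (rule eq_matI)
  have dims: "dim_row (folded_mat N \<epsilon>) = N" for \<epsilon> :: 'a
    using folded_mat_carrier by blast
  show "dim_row ((1 / 2) \<cdot>\<^sub>m (mat_poly p (alpha_mat N) + mat_poly p (beta_mat N)))
      = dim_row (leading_submat N (inf_mat_poly p gamma_mat))"
    "dim_col ((1 / 2) \<cdot>\<^sub>m (mat_poly p (alpha_mat N) + mat_poly p (beta_mat N)))
      = dim_col (leading_submat N (inf_mat_poly p gamma_mat))"
    by (simp_all add: mat_poly_def leading_submat_def beta_mat_eq_folded dims)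
  fix i j
  assume "i < dim_row (leading_submat N (inf_mat_poly p gamma_mat))"
    and "j < dim_col (leading_submat N (inf_mat_poly p gamma_mat))"
  then have ij: "i < N" "j < N"
    by (simp_all add: leading_submat_def)
  \<comment> \<open>The signed terms for \<epsilon> = 1 and \<epsilon> = -1 cancel; the rest is
    linearity in the coefficients.\<close>
  have "(alpha_mat N ^\<^sub>m k) $$ (i, j) + (beta_mat N ^\<^sub>m k) $$ (i, j)
      = 2 * inf_mat_pow (gamma_mat :: 'a inf_mat) k i j" if "k \<le> degree p" for k
    using that ij assms(2)
    by (simp add: alpha_mat_eq_folded beta_mat_eq_folded folded_mat_pow_index)
  then have "(\<Sum>k\<le>degree p. coeff p k * (alpha_mat N ^\<^sub>m k) $$ (i, j))
        + (\<Sum>k\<le>degree p. coeff p k * (beta_mat N ^\<^sub>m k) $$ (i, j))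
      = 2 * (\<Sum>k\<le>degree p. coeff p k * inf_mat_pow gamma_mat k i j)"
    unfolding sum.distrib[symmetric] sum_distrib_left
    by (intro sum.cong) (simp_all add: distrib_left[symmetric])
  then show "((1 / 2) \<cdot>\<^sub>m (mat_poly p (alpha_mat N) + mat_poly p (beta_mat N))) $$ (i, j)
      = leading_submat N (inf_mat_poly p gamma_mat) $$ (i, j)"
    using ij
    by (simp add: mat_poly_def leading_submat_def inf_mat_poly_def alpha_mat_eq_folded
        beta_mat_eq_folded dims)
qed

end
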